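(* For every positive integer $k$, in any election there exists a $\frac{9.8217}{k}$-undominated committee of size $k$.
   Context: An election consists of a finite set $V$ of $n$ voters, a finite set $C$ of $m$ candidates, and for each voter $v$ a strict linear order $\succ_v$ on $C$. A committee is a subset $S \subseteq C$. For a candidate $a$ and committee $S$, write $a \succ_v S$ if $v$ prefers $a$ to every member of $S$, and let $\frac1n|a \succ S| = \frac1n|\{v \in V : a \succ_v S\}|$. A committee $S$ is $\alpha$-undominated if for every candidate $a \in C$, $\frac1n|a \succ S| < \alpha$.
   Formalization: The formal theorem assumes k is at most the number m of candidates, since for k > m no committee of size k exists and the claim as written fails, and that there is at least one voter, so that 1/n is defined. *)

theory Defs
  imports Main Complex_Main
begin

text \<open>An election: finite nonempty voter set V, finite candidate set C, and for each
voter v a strict linear order P v on C (a pair (a,b) in P v means v prefers a to b).\<close>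
definition election :: "'v set \<Rightarrow> 'c set \<Rightarrow> ('v \<Rightarrow> ('c \<times> 'c) set) \<Rightarrow> bool" where
  "election V C P \<longleftrightarrow> finite V \<and> V \<noteq> {} \<and> finite C \<and>
     (\<forall>v\<in>V. strict_linear_order_on C (P v) \<and> P v \<subseteq> C \<times> C)"

definition prefers_over :: "('v \<Rightarrow> ('c \<times> 'c) set) \<Rightarrow> 'v \<Rightarrow> 'c \<Rightarrow> 'c set \<Rightarrow> bool" where
  "prefers_over P v a S \<longleftrightarrow> (\<forall>b\<in>S. (a, b) \<in> P v)"

definition dom_frac :: "'v set \<Rightarrow> ('v \<Rightarrow> ('c \<times> 'c) set) \<Rightarrow> 'c \<Rightarrow> 'c set \<Rightarrow> real" where
  "dom_frac V P a S = real (card {v \<in> V. prefers_over P v a S}) / real (card V)"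

definition undominated :: "'v set \<Rightarrow> 'c set \<Rightarrow> ('v \<Rightarrow> ('c \<times> 'c) set) \<Rightarrow> real \<Rightarrow> 'c set \<Rightarrow> bool" where
  "undominated V C P \<alpha> S \<longleftrightarrow> (\<forall>a\<in>C. dom_frac V P a S < \<alpha>)"

end

theory Submission
  imports Defs
begin

text \<open>
  Weigh the voters by \<open>w\<close>, with total \<open>W\<close>. By minimax there is a lottery over committees of
  size \<open>k\<^sub>0\<close> that every candidate beats with expected weight about \<open>W / (k\<^sub>0 + 1)\<close>. Let
  \<open>F v a\<close> be the probability that \<open>v\<close> prefers \<open>a\<close> to the random committee, and let \<open>U v S\<close> be
  the least \<open>F v a\<close> over the candidates \<open>a\<close> that \<open>v\<close> prefers to \<open>S\<close>. Since \<open>U v S\<close> is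
  stochastically at least uniform, some \<open>S\<^sub>0\<close> in the support satisfies
  \<open>\<Sum>v. w v * max 0 (1 - 2 * U v S\<^sub>0) \<le> W / 4\<close>. Recursion with these new weights yields \<open>S\<^sub>1\<close> of
  size \<open>k\<^sub>1 = k - k\<^sub>0\<close>. If \<open>a\<close> beats \<open>S\<^sub>0 \<union> S\<^sub>1\<close> for \<open>v\<close>, then
  \<open>1 \<le> max 0 (1 - 2 * U v S\<^sub>0) + 2 * F v a\<close>; summing, the weight of such voters is at most
  \<open>(8 / k\<^sub>1) (W / 4) + 2 W / (k\<^sub>0 + 1)\<close>. Halving \<open>k\<close> makes the constant \<open>8\<close> self-reproducing.
\<close>

section \<open>Averaging and a finite minimax alternative\<close>

lemma exists_le_weighted_average:
  fixes p f :: "'a \<Rightarrow> real"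
  assumes fin: "finite A" and p0: "\<And>x. x \<in> A \<Longrightarrow> 0 \<le> p x" and p1: "sum p A = 1"
    and le: "(\<Sum>x\<in>A. p x * f x) \<le> t"
  shows "\<exists>x\<in>A. f x \<le> t"
proof (rule ccontr)
  assume "\<not> ?thesis"
  then have gt: "f x > t" if "x \<in> A" for x using that by force
  have "(\<Sum>x\<in>A. p x * (f x - t)) = (\<Sum>x\<in>A. p x * f x) - t * sum p A"
    by (simp add: sum_distrib_left algebra_simps sum_subtractf)
  then have "(\<Sum>x\<in>A. p x * (f x - t)) \<le> 0" using p1 le by simp
  moreover have nonneg: "0 \<le> p x * (f x - t)" if "x \<in> A" for x
    using p0[OF that] gt[OF that] by simp
  ultimately have "(\<Sum>x\<in>A. p x * (f x - t)) = 0"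
    by (meson antisym sum_nonneg)
  then have "\<forall>x\<in>A. p x * (f x - t) = 0"
    using sum_nonneg_eq_0_iff[OF fin, of "\<lambda>x. p x * (f x - t)"] nonneg by blast
  then have "\<forall>x\<in>A. p x = 0" using gt by force
  then show False using p1 by simp
qed

text \<open>Planar separation of the convex set \<open>K\<close> from the open negative quadrant:
  points with \<open>b < 0\<close> force lower bounds on \<open>s\<close>, points with
  \<open>a < 0\<close> force upper bounds, and two conflicting bounds would put a mixture inside the
  quadrant.\<close>

lemma nonneg_combination_of_two:
  fixes K :: "(real \<times> real) set"
  assumes conv: "\<And>a b a' b' s. (a, b) \<in> K \<Longrightarrow> (a', b') \<in> K \<Longrightarrow> 0 \<le> s \<Longrightarrow> s \<le> 1 \<Longrightarrow>
      (s * a + (1 - s) * a', s * b + (1 - s) * b') \<in> K"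
    and none: "\<And>a b. (a, b) \<in> K \<Longrightarrow> a < 0 \<Longrightarrow> b < 0 \<Longrightarrow> False"
  shows "\<exists>s. 0 \<le> s \<and> s \<le> 1 \<and> (\<forall>(a, b)\<in>K. 0 \<le> s * a + (1 - s) * b)"
proof -
  \<comment> \<open>For \<open>b < 0\<close> the goal reads \<open>s \<ge> - b / (a - b)\<close>;
    the element \<open>0\<close> keeps \<open>L\<close> nonempty and \<open>s\<close>
    nonnegative.\<close>
  define L where "L = insert 0 {- b / (a - b) | a b. (a, b) \<in> K \<and> b < 0}"
  define s where "s = Sup L"
  have le1: "x \<le> 1" if "x \<in> L" for x
  proof -
    have "- b / (a - b) \<le> 1" if "(a, b) \<in> K" "b < 0" for a b
      using none[OF that(1)] that(2) by (cases "a < 0") (auto simp: field_simps)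
    with that show ?thesis by (auto simp: L_def)
  qed
  then have bdd: "bdd_above L" by (auto simp: bdd_above_def)
  have up: "x \<le> s" if "x \<in> L" for x
    unfolding s_def using that bdd by (rule cSup_upper)
  have "L \<noteq> {}" by (simp add: L_def)
  then have lub: "s \<le> z" if "\<And>x. x \<in> L \<Longrightarrow> x \<le> z" for z
    unfolding s_def using that by (rule cSup_least)
  have "0 \<le> s * a + (1 - s) * b" if ab: "(a, b) \<in> K" for a b
  proof -
    consider "b < 0" | "0 \<le> b" "0 \<le> a" | "0 \<le> b" "a < 0" by linarith
    then show ?thesis
    proof cases
      case 1
      then have "a - b > 0" using none[OF ab] by (cases "a < 0") auto
      moreover have "- b / (a - b) \<le> s" using 1 ab by (intro up) (auto simp: L_def)
      ultimately have "- b \<le> s * (a - b)" by (simp only: pos_divide_le_eq)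
      then show ?thesis by (simp add: algebra_simps)
    next
      case 2
      have "0 \<le> s" "s \<le> 1" using up[of 0] lub[OF le1] by (auto simp: L_def)
      then show ?thesis using 2 by simp
    next
      case 3
      have "s \<le> b / (b - a)"
      proof (rule lub)
        fix x assume "x \<in> L"
        then consider "x = 0" | a' b' where "(a', b') \<in> K" "b' < 0" "x = - b' / (a' - b')"
          by (auto simp: L_def)
        then show "x \<le> b / (b - a)"
        proof cases
          case 1
          then show ?thesis using 3 by simp
        next
          case (2 a' b')
          have a': "0 \<le> a'" using none[OF 2(1)] 2(2) by force
          have "b' * a \<le> b * a'"
          proof (rule ccontr)
            assume "\<not> ?thesis"
            then have lt: "b * a' < b' * a" by simp
            \<comment> \<open>The weight \<open>r\<close> puts the mixture on the diagonal, where
              both coordinates equal \<open>(b * a' - b' * a) / d < 0\<close>.\<close>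
            define d where "d = (a' - b') + (b - a)"
            have d: "d > 0" using 3 2(2) a' by (simp add: d_def)
            define r where "r = (a' - b') / d"
            have r1: "1 - r = (b - a) / d" using d by (simp add: r_def d_def field_simps)
            have "0 \<le> r" "r \<le> 1" using d 3 2(2) a' by (auto simp: r_def d_def field_simps)
            note mem = conv[OF ab 2(1) this]
            have "r * a + (1 - r) * a' = (b * a' - b' * a) / d"
              unfolding r1 using d by (simp add: r_def field_simps)
            moreover have "r * b + (1 - r) * b' = (b * a' - b' * a) / d"
              unfolding r1 using d by (simp add: r_def field_simps)
            moreover have "(b * a' - b' * a) / d < 0" using d lt by (simp add: divide_neg_pos)
            ultimately show False using none[OF mem] by simp
          qed
          then have "(- b') * (b - a) \<le> b * (a' - b')" by (simp add: algebra_simps)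
          moreover have "a' - b' > 0" "b - a > 0" using 2 3 a' by auto
          ultimately show ?thesis unfolding 2(3)
            by (simp only: pos_divide_le_eq pos_le_divide_eq times_divide_eq_left)
        qed
      qed
      moreover have "b - a > 0" using 3 by simp
      ultimately show ?thesis by (simp add: pos_le_divide_eq algebra_simps)
    qed
  qed
  moreover have "0 \<le> s" "s \<le> 1" using up[of 0] lub[OF le1] by (auto simp: L_def)
  ultimately show ?thesis by auto
qed

text \<open>This is minimax as an alternative, separating \<open>K\<close> from the open negative
  orthant. In the induction the coordinates in \<open>I\<close> are merged into one average, and the
  planar case balances it against \<open>j\<close>.\<close>

lemma nonneg_combination_if_no_all_neg:
  fixes K :: "('i \<Rightarrow> real) set"
  assumes "finite I" and "I \<noteq> {}"
    and "\<And>x y s. x \<in> K \<Longrightarrow> y \<in> K \<Longrightarrow> 0 \<le> s \<Longrightarrow> s \<le> 1 \<Longrightarrow> (\<lambda>i. s * x i + (1 - s) * y i) \<in> K"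
    and "\<And>x. x \<in> K \<Longrightarrow> \<exists>i\<in>I. 0 \<le> x i"
  shows "\<exists>p. (\<forall>i\<in>I. 0 \<le> p i) \<and> sum p I = 1 \<and> (\<forall>x\<in>K. 0 \<le> (\<Sum>i\<in>I. p i * x i))"
  using assms
proof (induction I arbitrary: K rule: finite_ne_induct)
  case (singleton i)
  then show ?case by (intro exI[of _ "\<lambda>_. 1"]) auto
next
  case (insert j I)
  \<comment> \<open>Points with \<open>x j < 0\<close> must be nonnegative somewhere in
    \<open>I\<close>, so the induction hypothesis applies to \<open>K'\<close>; its \<open>p\<close>
    keeps all pairs \<open>?h x\<close> out of the open negative quadrant.\<close>
  define K' where "K' = {x \<in> K. x j < 0}"
  have "\<exists>p. (\<forall>i\<in>I. 0 \<le> p i) \<and> sum p I = 1 \<and> (\<forall>x\<in>K'. 0 \<le> (\<Sum>i\<in>I. p i * x i))"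
  proof (rule insert.IH)
    fix x y :: "'i \<Rightarrow> real" and s :: real
    assume *: "x \<in> K'" "y \<in> K'" "0 \<le> s" "s \<le> 1"
    have "s * x j + (1 - s) * y j < 0"
    proof (cases "s = 0")
      case False
      then have "s * x j < 0" using * by (auto simp: K'_def mult_pos_neg)
      moreover have "(1 - s) * y j \<le> 0" using * by (auto simp: K'_def mult_nonneg_nonpos)
      ultimately show ?thesis by simp
    qed (use * in \<open>auto simp: K'_def\<close>)
    then show "(\<lambda>i. s * x i + (1 - s) * y i) \<in> K'"
      using * insert.prems(1)[of x y s] by (auto simp: K'_def)
  next
    fix x assume "x \<in> K'"
    then show "\<exists>i\<in>I. 0 \<le> x i" using insert.prems(2)[of x] by (auto simp: K'_def)
  qed
  then obtain p where p: "\<forall>i\<in>I. 0 \<le> p i" "sum p I = 1" "\<forall>x\<in>K'. 0 \<le> (\<Sum>i\<in>I. p i * x i)"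
    by blast
  let ?h = "\<lambda>x. ((\<Sum>i\<in>I. p i * x i), x j)"
  have "\<exists>s. 0 \<le> s \<and> s \<le> 1 \<and> (\<forall>(a, b)\<in>?h ` K. 0 \<le> s * a + (1 - s) * b)"
  proof (rule nonneg_combination_of_two)
    fix a b a' b' s
    assume "(a, b) \<in> ?h ` K" "(a', b') \<in> ?h ` K" and s: "0 \<le> s" "s \<le> (1::real)"
    then obtain x y where xy: "x \<in> K" "y \<in> K" "(a, b) = ?h x" "(a', b') = ?h y" by blast
    have "(s * a + (1 - s) * a', s * b + (1 - s) * b') = ?h (\<lambda>i. s * x i + (1 - s) * y i)"
      using xy by (simp add: sum_distrib_left sum.distrib sum_subtractf algebra_simps)
    then show "(s * a + (1 - s) * a', s * b + (1 - s) * b') \<in> ?h ` K"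
      using insert.prems(1)[OF xy(1,2) s] by (simp only: image_eqI)
  next
    fix a b assume "(a, b) \<in> ?h ` K" "a < 0" "b < 0"
    then show False using p(3) by (force simp: K'_def)
  qed
  then obtain s where s: "0 \<le> s" "s \<le> 1"
    and sK: "\<And>x. x \<in> K \<Longrightarrow> 0 \<le> s * (\<Sum>i\<in>I. p i * x i) + (1 - s) * x j" by auto
  define q where "q = (\<lambda>i. if i = j then 1 - s else s * p i)"
  have q: "(\<Sum>i\<in>insert j I. q i * x i) = s * (\<Sum>i\<in>I. p i * x i) + (1 - s) * x j" for x
  proof -
    have "(\<Sum>i\<in>I. q i * x i) = (\<Sum>i\<in>I. s * (p i * x i))"
      using insert.hyps by (intro sum.cong) (auto simp: q_def)
    then show ?thesis using insert.hyps by (simp add: q_def sum_distrib_left)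
  qed
  show ?case
  proof (intro exI conjI ballI)
    fix i assume "i \<in> insert j I"
    then show "0 \<le> q i" using s p(1) by (auto simp: q_def)
  next
    show "sum q (insert j I) = 1" using q[of "\<lambda>_. 1"] p(2) by simp
  next
    fix x assume "x \<in> K"
    then show "0 \<le> (\<Sum>i\<in>insert j I. q i * x i)" using sK q by simp
  qed
qed

section \<open>Sampling and stable lotteries\<close>

text \<open>Conditional expectations: \<open>S\<close> plays the role of \<open>k\<close> independent samples from \<open>p\<close>.\<close>

lemma exists_sample_le_expectation:
  fixes p :: "'c \<Rightarrow> real" and q :: "'j \<Rightarrow> real"
  assumes "finite C" and "\<And>c. c \<in> C \<Longrightarrow> 0 \<le> p c" and "sum p C = 1"
  shows "\<exists>S\<subseteq>C. card S \<le> k \<and> (\<Sum>j\<in>J. q j * of_bool (\<forall>s\<in>S. R j s))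
           \<le> (\<Sum>j\<in>J. q j * (\<Sum>s\<in>C. p s * of_bool (R j s)) ^ k)"
proof (induction k arbitrary: q)
  case 0
  show ?case by (intro exI[of _ "{}"]) auto
next
  case (Suc k)
  let ?L = "\<lambda>j. \<Sum>s\<in>C. p s * of_bool (R j s)"
  have "(\<Sum>s\<in>C. p s * (\<Sum>j\<in>J. q j * of_bool (R j s) * ?L j ^ k)) =
      (\<Sum>j\<in>J. \<Sum>s\<in>C. p s * (q j * of_bool (R j s) * ?L j ^ k))"
    by (subst sum.swap) (simp only: sum_distrib_left)
  also have "\<dots> = (\<Sum>j\<in>J. q j * ?L j ^ Suc k)"
    by (intro sum.cong refl) (simp add: sum_distrib_left sum_distrib_right ac_simps)
  finally have "\<exists>s\<in>C. (\<Sum>j\<in>J. q j * of_bool (R j s) * ?L j ^ k) \<le> (\<Sum>j\<in>J. q j * ?L j ^ Suc k)"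
    by (intro exists_le_weighted_average[OF assms] eq_refl)
  then obtain s where s: "s \<in> C"
    "(\<Sum>j\<in>J. q j * of_bool (R j s) * ?L j ^ k) \<le> (\<Sum>j\<in>J. q j * ?L j ^ Suc k)"
    by blast
  \<comment> \<open>With the first sample \<open>s\<close> fixed, its event is absorbed into the
    weight, hence the induction over arbitrary \<open>q\<close>. Samples may repeat, so only
    \<open>card S \<le> k\<close> is claimed.\<close>
  obtain S where S: "S \<subseteq> C" "card S \<le> k"
    "(\<Sum>j\<in>J. q j * of_bool (R j s) * of_bool (\<forall>s\<in>S. R j s))
       \<le> (\<Sum>j\<in>J. q j * of_bool (R j s) * ?L j ^ k)"
    using Suc.IH[of "\<lambda>j. q j * of_bool (R j s)"] by blast
  have "(\<Sum>j\<in>J. q j * of_bool (\<forall>t\<in>insert s S. R j t)) =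
      (\<Sum>j\<in>J. q j * of_bool (R j s) * of_bool (\<forall>t\<in>S. R j t))"
    by (intro sum.cong) auto
  then show ?case
    using S(1,2) s(1) order_trans[OF S(3) s(2)] finite_subset[OF S(1) assms(1)]
    by (intro exI[of _ "insert s S"]) (simp add: card_insert_if)
qed

lemma strict_linear_order_has_top:
  assumes lin: "strict_linear_order_on C r" and "finite A" "A \<noteq> {}" "A \<subseteq> C"
  shows "\<exists>a\<in>A. \<forall>b\<in>A. b \<noteq> a \<longrightarrow> (a, b) \<in> r"
  using assms(2-)
proof (induction A rule: finite_ne_induct)
  case (insert x A)
  then obtain a where a: "a \<in> A" "\<forall>b\<in>A. b \<noteq> a \<longrightarrow> (a, b) \<in> r" by auto
  have "x \<noteq> a" using insert a by auto
  then have "(a, x) \<in> r \<or> (x, a) \<in> r"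
    using lin a insert.prems by (auto simp: strict_linear_order_on_def total_on_def)
  moreover have "trans r" using lin by (simp add: strict_linear_order_on_def)
  ultimately show ?case using a by (metis insert_iff transD)
qed simp

text \<open>Two terms of the binomial expansion; the others are nonnegative.\<close>

lemma power_Suc_add_ge:
  fixes x y :: real
  assumes "0 \<le> x" "0 \<le> y"
  shows "real (Suc k) * (x * y ^ k) + y ^ Suc k \<le> (x + y) ^ Suc k"
proof (induction k)
  case (Suc k)
  have "(x + y) * (real (Suc k) * (x * y ^ k) + y ^ Suc k) \<le> (x + y) * (x + y) ^ Suc k"
    using Suc assms by (intro mult_left_mono) auto
  moreover have "0 \<le> real (Suc k) * x * x * y ^ k" using assms by simp
  ultimately show ?case by (simp add: algebra_simps)
qed simp

text \<open>Telescoping along the order: \<open>(k + 1) x y\<^sup>k \<le> (x + y)\<^sup>k\<^sup>+\<^sup>1 - y\<^sup>k\<^sup>+\<^sup>1\<close>.\<close>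

lemma sum_mass_below_power_le:
  fixes p :: "'c \<Rightarrow> real"
  assumes lin: "strict_linear_order_on C r" and "finite A" "A \<subseteq> C"
    and "\<And>c. c \<in> C \<Longrightarrow> 0 \<le> p c"
  shows "real (Suc k) * (\<Sum>a\<in>A. p a * (\<Sum>b\<in>A. p b * of_bool ((a, b) \<in> r)) ^ k) \<le> sum p A ^ Suc k"
  using assms(2,3)
proof (induction "card A" arbitrary: A)
  case (Suc n)
  then have "A \<noteq> {}" by auto
  then obtain a where a: "a \<in> A" "\<forall>b\<in>A. b \<noteq> a \<longrightarrow> (a, b) \<in> r"
    using strict_linear_order_has_top[OF lin] Suc.prems by blast
  define B where "B = A - {a}"
  have A: "A = insert a B" "a \<notin> B" "finite B" "B \<subseteq> C" using a Suc.prems by (auto simp: B_def)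
  have irr: "(x, x) \<notin> r" for x using lin by (auto simp: strict_linear_order_on_def irrefl_def)
  have tr: "trans r" using lin by (simp add: strict_linear_order_on_def)
  have notin: "(b, a) \<notin> r" if "b \<in> B" for b
    using a(2) that irr[of a] transD[OF tr, of a b a] by (auto simp: B_def)
  \<comment> \<open>The top \<open>a\<close> has all of \<open>B\<close> below it and lies below
    none of \<open>B\<close>, so deleting it leaves the inner sums for \<open>B\<close>
    unchanged.\<close>
  have La: "(\<Sum>b\<in>A. p b * of_bool ((a, b) \<in> r)) = sum p B"
    using A a irr by (auto simp: B_def intro!: sum.cong)
  have Lb: "(\<Sum>c\<in>A. p c * of_bool ((b, c) \<in> r)) = (\<Sum>c\<in>B. p c * of_bool ((b, c) \<in> r))"
    if "b \<in> B" for b using A notin[OF that] by simp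
  have "(\<Sum>b\<in>A. p b * (\<Sum>c\<in>A. p c * of_bool ((b, c) \<in> r)) ^ k) =
      p a * sum p B ^ k + (\<Sum>b\<in>B. p b * (\<Sum>c\<in>A. p c * of_bool ((b, c) \<in> r)) ^ k)"
    using A(2,3) La by (simp add: A(1))
  also have "\<dots> = p a * sum p B ^ k + (\<Sum>b\<in>B. p b * (\<Sum>c\<in>B. p c * of_bool ((b, c) \<in> r)) ^ k)"
    using Lb by simp
  finally have "real (Suc k) * (\<Sum>b\<in>A. p b * (\<Sum>c\<in>A. p c * of_bool ((b, c) \<in> r)) ^ k) =
      real (Suc k) * (p a * sum p B ^ k) +
      real (Suc k) * (\<Sum>b\<in>B. p b * (\<Sum>c\<in>B. p c * of_bool ((b, c) \<in> r)) ^ k)"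
    by (simp only: distrib_left)
  also have "\<dots> \<le> real (Suc k) * (p a * sum p B ^ k) + sum p B ^ Suc k"
    using Suc.hyps(1)[of B] Suc.hyps(2) A by simp
  also have "\<dots> \<le> (p a + sum p B) ^ Suc k"
    using A assms(4) Suc.prems by (intro power_Suc_add_ge sum_nonneg) auto
  finally show ?case using A by simp
qed simp

text \<open>Against a fixed distribution \<open>p\<close> of challengers, \<open>k\<close> independent
  samples from \<open>p\<close> work, so the minimax alternative applies.\<close>

lemma exists_stable_lottery:
  fixes w :: "'v \<Rightarrow> real" and P :: "'v \<Rightarrow> ('c \<times> 'c) set"
  assumes finC: "finite C" and C: "C \<noteq> {}" and w: "\<And>v. v \<in> V \<Longrightarrow> 0 \<le> w v"
    and lin: "\<And>v. v \<in> V \<Longrightarrow> strict_linear_order_on C (P v)"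
    and t: "sum w V < real (Suc k) * t"
  defines "\<C> \<equiv> {S. S \<subseteq> C \<and> card S \<le> k}"
  shows "\<exists>\<mu>. (\<forall>S\<in>\<C>. 0 \<le> \<mu> S) \<and> sum \<mu> \<C> = 1 \<and>
    (\<forall>a\<in>C. (\<Sum>S\<in>\<C>. \<mu> S * (\<Sum>v\<in>V. w v * of_bool (prefers_over P v a S))) < t)"
proof (rule ccontr)
  assume neg: "\<not> ?thesis"
  let ?M = "\<lambda>a S. \<Sum>v\<in>V. w v * of_bool (prefers_over P v a S)"
  define D where "D = {\<mu>. (\<forall>S\<in>\<C>. 0 \<le> \<mu> S) \<and> sum \<mu> \<C> = (1::real)}"
  define pay where "pay \<mu> a = (\<Sum>S\<in>\<C>. \<mu> S * ?M a S) - t" for \<mu> a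
  have fin\<C>: "finite \<C>" using finC by (simp add: \<C>_def)
  \<comment> \<open>The negated claim gives every lottery a challenger with nonnegative
    \<open>pay\<close>; the alternative yields one mixed challenger \<open>p\<close> that works
    against all lotteries.\<close>
  have "\<exists>p. (\<forall>a\<in>C. 0 \<le> p a) \<and> sum p C = 1 \<and> (\<forall>x\<in>pay ` D. 0 \<le> (\<Sum>a\<in>C. p a * x a))"
  proof (rule nonneg_combination_if_no_all_neg[OF finC C])
    fix x y and s :: real assume "x \<in> pay ` D" "y \<in> pay ` D" and s: "0 \<le> s" "s \<le> 1"
    then obtain \<mu> \<nu> where m: "\<mu> \<in> D" "\<nu> \<in> D" "x = pay \<mu>" "y = pay \<nu>" by blast
    let ?m = "\<lambda>S. s * \<mu> S + (1 - s) * \<nu> S"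
    have "?m \<in> D"
      using m s by (auto simp: D_def sum.distrib sum_distrib_left[symmetric])
    moreover have "(\<lambda>i. s * x i + (1 - s) * y i) = pay ?m"
      by (rule ext)
        (simp add: m pay_def distrib_right sum.distrib mult.assoc sum_distrib_left[symmetric]
          right_diff_distrib left_diff_distrib sum_subtractf)
    ultimately show "(\<lambda>i. s * x i + (1 - s) * y i) \<in> pay ` D" by blast
  next
    fix x assume "x \<in> pay ` D"
    then obtain \<mu> where "\<mu> \<in> D" "x = pay \<mu>" by blast
    then show "\<exists>a\<in>C. 0 \<le> x a" using neg by (force simp: D_def pay_def)
  qed
  then obtain p where p: "\<And>a. a \<in> C \<Longrightarrow> 0 \<le> p a" "sum p C = 1"
    and pD: "\<And>\<mu>. \<mu> \<in> D \<Longrightarrow> 0 \<le> (\<Sum>a\<in>C. p a * pay \<mu> a)" by blast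
  let ?J = "V \<times> C"
  obtain S where S: "S \<subseteq> C" "card S \<le> k"
    "(\<Sum>(v,a)\<in>?J. w v * p a * of_bool (\<forall>s\<in>S. (a, s) \<in> P v))
      \<le> (\<Sum>(v,a)\<in>?J. w v * p a * (\<Sum>s\<in>C. p s * of_bool ((a, s) \<in> P v)) ^ k)"
    using exists_sample_le_expectation[OF finC p, where J = ?J and k = k
        and q = "\<lambda>(v,a). w v * p a" and R = "\<lambda>(v,a) s. (a, s) \<in> P v"]
    by (force simp: case_prod_unfold)
  have "real (Suc k) * (\<Sum>a\<in>C. p a * ?M a S) =
      real (Suc k) * (\<Sum>(v,a)\<in>?J. w v * p a * of_bool (\<forall>s\<in>S. (a, s) \<in> P v))"
    by (simp only: sum_distrib_left prefers_over_def sum.cartesian_product[symmetric])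
      (subst sum.swap, simp add: ac_simps)
  also have "\<dots> \<le> real (Suc k) *
      (\<Sum>(v,a)\<in>?J. w v * p a * (\<Sum>s\<in>C. p s * of_bool ((a, s) \<in> P v)) ^ k)"
    using S(3) by (intro mult_left_mono) auto
  also have "\<dots> = (\<Sum>v\<in>V. w v *
      (real (Suc k) * (\<Sum>a\<in>C. p a * (\<Sum>s\<in>C. p s * of_bool ((a, s) \<in> P v)) ^ k)))"
    by (simp only: sum.cartesian_product[symmetric] sum_distrib_left ac_simps)
  also have "\<dots> \<le> (\<Sum>v\<in>V. w v * 1)"
  proof (intro sum_mono mult_left_mono w)
    fix v assume "v \<in> V"
    from sum_mass_below_power_le[where p = p and k = k, OF lin[OF this] finC order_refl p(1)]
    show "real (Suc k) * (\<Sum>a\<in>C. p a * (\<Sum>s\<in>C. p s * of_bool ((a, s) \<in> P v)) ^ k) \<le> 1"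
      using p(2) by simp
  qed
  also have "\<dots> < real (Suc k) * t" using t by simp
  finally have lt: "(\<Sum>a\<in>C. p a * ?M a S) < t"
    by (simp only: mult_less_cancel_left_pos of_nat_0_less_iff zero_less_Suc)
  \<comment> \<open>The point mass at \<open>S\<close> is a lottery in \<open>D\<close>, so
    \<open>p\<close> must have nonnegative expected \<open>pay\<close> against it, contrary to
    \<open>lt\<close>.\<close>
  define \<delta> where "\<delta> T = (of_bool (T = S) :: real)" for T
  have S\<C>: "S \<in> \<C>" using S by (simp add: \<C>_def)
  have \<delta>: "(\<Sum>T\<in>\<C>. \<delta> T * f T) = f S" for f :: "_ \<Rightarrow> real"
  proof -
    have "(\<Sum>T\<in>\<C>. \<delta> T * f T) = (\<Sum>T\<in>\<C>. if T = S then f T else 0)"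
      by (intro sum.cong) (auto simp: \<delta>_def)
    then show ?thesis using S\<C> fin\<C> by simp
  qed
  have "\<delta> \<in> D" using \<delta>[of "\<lambda>_. 1"] by (simp add: D_def) (simp add: \<delta>_def)
  then have "0 \<le> (\<Sum>a\<in>C. p a * (?M a S - t))" using pD[of \<delta>] by (simp add: pay_def \<delta>)
  also have "\<dots> = (\<Sum>a\<in>C. p a * ?M a S) - t"
    using p(2) by (simp add: right_diff_distrib sum_subtractf sum_distrib_right[symmetric])
  finally show False using lt by simp
qed

section \<open>Rank of a random committee for a single voter\<close>

text \<open>If \<open>U\<close> is stochastically at least uniform on \<open>[0, 1]\<close>, then
  \<open>E max(0, 1 - 2 U) \<le> \<integral>\<^sub>0\<^sup>1 max(0, 1 - 2 u) du = 1/4\<close>.\<close>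

lemma expected_hinge_le:
  fixes \<mu> U :: "'a \<Rightarrow> real"
  assumes fin: "finite A" and m0: "\<And>x. x \<in> A \<Longrightarrow> 0 \<le> \<mu> x"
    and dom: "\<And>x. x \<in> A \<Longrightarrow> U x < 1/2 \<Longrightarrow> sum \<mu> {y \<in> A. U y \<le> U x} \<le> U x"
  shows "(\<Sum>x\<in>A. \<mu> x * max 0 (1 - 2 * U x)) \<le> 1/4"
proof -
  define B where "B = {x \<in> A. U x < 1/2}"
  have fB: "finite B" using fin by (simp add: B_def)
  \<comment> \<open>Symmetrization replaces the integral: each pair in \<open>B\<close> is ordered
    by \<open>U\<close> in at least one direction, so \<open>m = sum \<mu> B\<close> satisfies
    \<open>m^2 \<le> 2 * T\<close>. As \<open>T \<le> (\<Sum>x\<in>B. \<mu> x * U x)\<close>, the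
    hinge sum is at most \<open>m - m^2 \<le> 1/4\<close>.\<close>
  define T where "T = (\<Sum>x\<in>B. \<Sum>y\<in>B. \<mu> x * \<mu> y * of_bool (U y \<le> U x))"
  have "T = (\<Sum>x\<in>B. \<Sum>y\<in>B. \<mu> x * \<mu> y * of_bool (U x \<le> U y))"
    unfolding T_def by (subst sum.swap) (simp add: ac_simps)
  then have "2 * T = (\<Sum>x\<in>B. \<Sum>y\<in>B. \<mu> x * \<mu> y * (of_bool (U y \<le> U x) + of_bool (U x \<le> U y)))"
    by (simp add: T_def sum.distrib distrib_left)
  also have "\<dots> \<ge> (\<Sum>x\<in>B. \<Sum>y\<in>B. \<mu> x * \<mu> y * 1)"
    using m0 by (intro sum_mono mult_left_mono) (auto simp: B_def)
  finally have T: "(sum \<mu> B)\<^sup>2 \<le> 2 * T"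
    by (simp add: power2_eq_square sum_product)
  have "T \<le> (\<Sum>x\<in>B. \<mu> x * U x)"
    unfolding T_def
  proof (rule sum_mono)
    fix x assume x: "x \<in> B"
    have "(\<Sum>y\<in>B. \<mu> x * \<mu> y * of_bool (U y \<le> U x)) = \<mu> x * (\<Sum>y\<in>B. if U y \<le> U x then \<mu> y else 0)"
      by (simp add: sum_distrib_left mult.assoc) (intro sum.cong, auto)
    also have "(\<Sum>y\<in>B. if U y \<le> U x then \<mu> y else 0) = sum \<mu> {y \<in> B. U y \<le> U x}"
      using fB by (simp add: sum.inter_filter)
    also have "{y \<in> B. U y \<le> U x} = {y \<in> A. U y \<le> U x}" using x by (auto simp: B_def)
    finally show "(\<Sum>y\<in>B. \<mu> x * \<mu> y * of_bool (U y \<le> U x)) \<le> \<mu> x * U x"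
      using x m0 dom by (auto simp: B_def intro: mult_left_mono)
  qed
  moreover have "(\<Sum>x\<in>A. \<mu> x * max 0 (1 - 2 * U x)) = (\<Sum>x\<in>B. \<mu> x * (1 - 2 * U x))"
    using fin by (intro sum.mono_neutral_cong_right) (auto simp: B_def)
  moreover have "\<dots> = sum \<mu> B - 2 * (\<Sum>x\<in>B. \<mu> x * U x)"
    by (simp add: right_diff_distrib sum_subtractf sum_distrib_left ac_simps)
  moreover have "sum \<mu> B - (sum \<mu> B)\<^sup>2 \<le> 1/4"
    using zero_le_power2[of "sum \<mu> B - 1/2"] by (simp add: power2_eq_square algebra_simps)
  ultimately show ?thesis using T by linarith
qed

text \<open>\<open>F\<close> is the winning probability against the lottery; the most preferred
  candidate with \<open>F a \<le> u\<close> beats every committee of rank at most \<open>u\<close>.\<close>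

lemma mass_low_rank_le:
  fixes \<mu> :: "'c set \<Rightarrow> real" and P :: "'v \<Rightarrow> ('c \<times> 'c) set"
  assumes finC: "finite C" and lin: "strict_linear_order_on C (P v)"
    and fin: "finite \<C>" and m0: "\<And>S. S \<in> \<C> \<Longrightarrow> 0 \<le> \<mu> S"
  defines "F \<equiv> \<lambda>a. \<Sum>S\<in>\<C>. \<mu> S * of_bool (prefers_over P v a S)"
  defines "U \<equiv> \<lambda>S. Min (insert 1 (F ` {a \<in> C. prefers_over P v a S}))"
  assumes u: "0 \<le> u" "u < 1"
  shows "sum \<mu> {S \<in> \<C>. U S \<le> u} \<le> u"
proof -
  define Z where "Z = {a \<in> C. F a \<le> u}"
  have low: "\<exists>a\<in>Z. prefers_over P v a S" if "U S \<le> u" for S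
  proof -
    \<comment> \<open>The default \<open>1\<close> covers committees to which \<open>v\<close>
      prefers no candidate; as \<open>u < 1\<close>, a minimum at most \<open>u\<close> comes from a
      candidate.\<close>
    have "U S \<in> insert 1 (F ` {a \<in> C. prefers_over P v a S})"
      unfolding U_def using finC by (intro Min_in) auto
    then show ?thesis using that u by (auto simp: Z_def)
  qed
  show ?thesis
  proof (cases "Z = {}")
    case True
    then have "{S \<in> \<C>. U S \<le> u} = {}" using low by blast
    then show ?thesis using u by (simp only: sum.empty)
  next
    case False
    then obtain a where a: "a \<in> Z" "\<forall>b\<in>Z. b \<noteq> a \<longrightarrow> (a, b) \<in> P v"
      using strict_linear_order_has_top[OF lin, of Z] finC by (auto simp: Z_def)
    have tr: "trans (P v)" using lin by (simp add: strict_linear_order_on_def)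
    have beats: "prefers_over P v a S" if S: "U S \<le> u" for S
    proof -
      obtain b where "b \<in> Z" "prefers_over P v b S" using low[OF S] by blast
      then show ?thesis using a(2) tr by (metis prefers_over_def transD)
    qed
    have "sum \<mu> {S \<in> \<C>. U S \<le> u} \<le> sum \<mu> {S \<in> \<C>. prefers_over P v a S}"
      using fin m0 beats by (intro sum_mono2) auto
    also have "\<dots> = (\<Sum>S\<in>\<C>. if prefers_over P v a S then \<mu> S else 0)"
      using fin by (simp add: sum.inter_filter)
    also have "\<dots> = F a" unfolding F_def by (intro sum.cong) auto
    also have "\<dots> \<le> u" using a by (simp add: Z_def)
    finally show ?thesis .
  qed
qed

section \<open>Halving recursion on the committee size\<close>

text \<open>Arbitrary weights make the recursion possible: the second half of the committee solves
  the same problem for reweighted voters.\<close>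

lemma exists_committee_weighted:
  fixes w :: "'v \<Rightarrow> real" and P :: "'v \<Rightarrow> ('c \<times> 'c) set"
  assumes finC: "finite C" and C: "C \<noteq> {}" and finV: "finite V"
    and lin: "\<And>v. v \<in> V \<Longrightarrow> strict_linear_order_on C (P v)"
    and "k > 0" and "\<And>v. v \<in> V \<Longrightarrow> 0 \<le> w v"
  shows "\<exists>S\<subseteq>C. card S \<le> k \<and>
    (\<forall>a\<in>C. real k * (\<Sum>v\<in>V. w v * of_bool (prefers_over P v a S)) \<le> 8 * sum w V)"
  using assms(5,6)
proof (induction k arbitrary: w rule: less_induct)
  case (less k)
  let ?W = "sum w V"
  have W0: "0 \<le> ?W" using less.prems by (intro sum_nonneg) auto
  have triv: "(\<Sum>v\<in>V. w v * of_bool (prefers_over P v a S)) \<le> ?W" for a S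
    using less.prems by (intro sum_mono) auto
  \<comment> \<open>In the first two cases \<open>triv\<close> suffices, with the empty committee;
    \<open>?W > 0\<close> later gives the strict slack in \<open>t\<close>.\<close>
  consider "k = 1" | "?W = 0" | "k \<ge> 2" "?W > 0" using W0 less.prems by linarith
  then show ?case
  proof cases
    case 1
    then show ?thesis
      using W0 by (intro exI[of _ "{}"]) (force intro: order_trans[OF triv])
  next
    case 2
    then show ?thesis
      using triv by (intro exI[of _ "{}"]) (auto simp: mult_nonneg_nonpos)
  next
    case 3
    \<comment> \<open>Rounding \<open>k0\<close> down and \<open>k1\<close> up gives
      \<open>k \<le> 2 * k0 + 1\<close> and \<open>k \<le> 2 * k1\<close>, the two bounds used at
      the end.\<close>
    define k0 where "k0 = k div 2"
    define k1 where "k1 = k - k0"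
    have k01: "k1 < k" "0 < k1" "k0 + k1 = k" "2 * k0 = k \<or> 2 * k0 + 1 = k"
      using 3(1) by (auto simp: k0_def k1_def)
    define \<C> where "\<C> = {S. S \<subseteq> C \<and> card S \<le> k0}"
    have fin\<C>: "finite \<C>" using finC by (simp add: \<C>_def)
    \<comment> \<open>Slightly above \<open>?W / (k0 + 1)\<close>, as the lottery lemma needs strict slack.\<close>
    define t where "t = 2 * ?W / real (2 * k0 + 1)"
    have "?W < real (Suc k0) * t" using 3(2) by (simp add: t_def field_simps)
    from exists_stable_lottery[where V = V and P = P, OF finC C less.prems(2) lin this]
    obtain \<mu> where \<mu>: "\<And>S. S \<in> \<C> \<Longrightarrow> 0 \<le> \<mu> S" "sum \<mu> \<C> = 1"
      and stable: "\<And>a. a \<in> C \<Longrightarrow>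
        (\<Sum>S\<in>\<C>. \<mu> S * (\<Sum>v\<in>V. w v * of_bool (prefers_over P v a S))) < t"
      unfolding \<C>_def by blast
    define F where "F v a = (\<Sum>S\<in>\<C>. \<mu> S * of_bool (prefers_over P v a S))" for v a
    define U where "U v S = Min (insert 1 (F v ` {a \<in> C. prefers_over P v a S}))" for v S
    have F0: "0 \<le> F v a" for v a unfolding F_def using \<mu>(1) by (intro sum_nonneg) auto
    have U0: "0 \<le> U v S" for v S
      unfolding U_def using finC F0 by (intro Min.boundedI) auto
    have UF: "U v S \<le> F v a" if "a \<in> C" "prefers_over P v a S" for v a S
      unfolding U_def using finC that by (intro Min_le) auto
    \<comment> \<open>A small \<open>U v S\<close> means that \<open>S\<close> serves
      \<open>v\<close> badly: some candidate that rarely beats the lottery for \<open>v\<close>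
      beats \<open>S\<close>. Only voters with rank below \<open>1/2\<close> keep weight.\<close>
    let ?g = "\<lambda>v S. max 0 (1 - 2 * U v S)"
    have "(\<Sum>S\<in>\<C>. \<mu> S * (\<Sum>v\<in>V. w v * ?g v S)) = (\<Sum>v\<in>V. w v * (\<Sum>S\<in>\<C>. \<mu> S * ?g v S))"
      by (simp only: sum_distrib_left) (subst sum.swap, simp only: ac_simps)
    also have "\<dots> \<le> (\<Sum>v\<in>V. w v * (1/4))"
    proof (intro sum_mono mult_left_mono expected_hinge_le fin\<C> \<mu>(1) less.prems(2))
      fix v S assume v: "v \<in> V" and "U v S < 1/2"
      then show "sum \<mu> {T \<in> \<C>. U v T \<le> U v S} \<le> U v S"
        using mass_low_rank_le[where P = P and v = v and \<mu> = \<mu> and u = "U v S",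
            OF finC lin[OF v] fin\<C> \<mu>(1)] U0[of v S]
        by (simp add: U_def F_def [abs_def])
    qed
    finally obtain S0 where S0: "S0 \<in> \<C>" "(\<Sum>v\<in>V. w v * ?g v S0) \<le> ?W / 4"
      using exists_le_weighted_average[OF fin\<C> \<mu>, where t = "?W / 4"]
      by (fastforce simp: sum_divide_distrib)
    obtain S1 where S1: "S1 \<subseteq> C" "card S1 \<le> k1"
      and bound1: "\<And>a. a \<in> C \<Longrightarrow> real k1 *
        (\<Sum>v\<in>V. w v * ?g v S0 * of_bool (prefers_over P v a S1)) \<le> 8 * (\<Sum>v\<in>V. w v * ?g v S0)"
      using less.IH[OF k01(1,2), of "\<lambda>v. w v * ?g v S0"] less.prems(2) by auto
    show ?thesis
    proof (intro exI[of _ "S0 \<union> S1"] conjI ballI)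
      show "S0 \<union> S1 \<subseteq> C" using S0 S1 by (auto simp: \<C>_def)
      show "card (S0 \<union> S1) \<le> k"
        using card_Un_le[of S0 S1] S0 S1 k01(3) by (auto simp: \<C>_def)
      fix a assume a: "a \<in> C"
      define X where "X = (\<Sum>v\<in>V. w v * ?g v S0 * of_bool (prefers_over P v a S1))"
      define Y where "Y = (\<Sum>v\<in>V. w v * F v a)"
      have "(\<Sum>v\<in>V. w v * of_bool (prefers_over P v a (S0 \<union> S1))) \<le>
          (\<Sum>v\<in>V. w v * (?g v S0 * of_bool (prefers_over P v a S1) + 2 * F v a))"
      proof (intro sum_mono mult_left_mono less.prems(2))
        fix v
        \<comment> \<open>If \<open>a\<close> beats the union, then
          \<open>U v S0 \<le> F v a\<close>, so the hinge is at least
          \<open>1 - 2 * F v a\<close>.\<close>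
        show "of_bool (prefers_over P v a (S0 \<union> S1)) \<le>
            ?g v S0 * of_bool (prefers_over P v a S1) + 2 * F v a"
        proof (cases "prefers_over P v a (S0 \<union> S1)")
          case True
          then have "prefers_over P v a S0" "prefers_over P v a S1"
            by (auto simp: prefers_over_def)
          then show ?thesis using True UF[OF a, of v S0] by simp
        next
          case False
          then show ?thesis using F0[of v a] by simp
        qed
      qed
      also have "\<dots> = X + 2 * Y"
        by (simp add: X_def Y_def distrib_left sum.distrib sum_distrib_left ac_simps)
      finally have main: "(\<Sum>v\<in>V. w v * of_bool (prefers_over P v a (S0 \<union> S1))) \<le> X + 2 * Y" .
      \<comment> \<open>Summed over the voters, the winning probabilities give the expected weight
        that \<open>stable\<close> bounds.\<close>
      have "Y = (\<Sum>S\<in>\<C>. \<mu> S * (\<Sum>v\<in>V. w v * of_bool (prefers_over P v a S)))"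
        unfolding Y_def F_def
        by (simp only: sum_distrib_left) (subst sum.swap, simp only: ac_simps)
      then have Y: "Y \<le> t" using stable[OF a] by simp
      have X: "X \<le> 2 * ?W / real k1"
        using bound1[OF a] S0(2) k01(2) by (simp add: X_def field_simps)
      \<comment> \<open>After multiplication by \<open>k\<close>, the recursive share and the
        lottery share are each at most \<open>4 * ?W\<close>, by \<open>k \<le> 2 * k1\<close> and
        \<open>k \<le> 2 * k0 + 1\<close>; so \<open>8\<close> reproduces itself.\<close>
      have "real k * (2 * ?W) \<le> (2 * real k1) * (2 * ?W)"
        using k01(3,4) W0 by (intro mult_right_mono) auto
      then have "real k * (2 * ?W / real k1) \<le> 4 * ?W"
        using k01(2) by (simp add: field_simps)
      moreover have "real k * (4 * ?W) \<le> real (2 * k0 + 1) * (4 * ?W)"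
        using k01(4) W0 by (intro mult_right_mono) auto
      then have "real k * (2 * t) \<le> 4 * ?W"
        by (simp add: t_def pos_divide_le_eq add_nonneg_pos algebra_simps)
      ultimately have "real k * (2 * ?W / real k1 + 2 * t) \<le> 8 * ?W"
        unfolding distrib_left by linarith
      moreover have "real k * (\<Sum>v\<in>V. w v * of_bool (prefers_over P v a (S0 \<union> S1)))
          \<le> real k * (2 * ?W / real k1 + 2 * t)"
        using main X Y by (intro mult_left_mono) auto
      ultimately show "real k * (\<Sum>v\<in>V. w v * of_bool (prefers_over P v a (S0 \<union> S1))) \<le> 8 * ?W"
        by linarith
    qed
  qed
qed

theorem theorem2:
  fixes V :: "'v set" and C :: "'c set" and P :: "'v \<Rightarrow> ('c \<times> 'c) set" and k :: nat
  assumes "election V C P" and "k > 0" and "k \<le> card C"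
  shows "\<exists>S \<subseteq> C. card S = k \<and> undominated V C P (9.8217 / real k) S"
proof -
  have finV: "finite V" "V \<noteq> {}" and finC: "finite C"
    and lin: "\<And>v. v \<in> V \<Longrightarrow> strict_linear_order_on C (P v)"
    using assms(1) by (auto simp: election_def)
  have "C \<noteq> {}" using assms(2,3) by auto
  then obtain S where S: "S \<subseteq> C" "card S \<le> k"
    "\<And>a. a \<in> C \<Longrightarrow> real k * (\<Sum>v\<in>V. of_bool (prefers_over P v a S)) \<le> 8 * real (card V)"
    using exists_committee_weighted[where w = "\<lambda>_. 1" and V = V and P = P, OF finC _ finV(1) lin assms(2)] by auto
  \<comment> \<open>Padding to size exactly \<open>k\<close> is harmless: enlarging a committee
    never adds voters who prefer \<open>a\<close> to it.\<close>
  obtain T where T: "S \<subseteq> T" "T \<subseteq> C" "card T = k"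
    using exists_subset_between[of S k C] S assms(3) finC by blast
  have "dom_frac V P a T < 9.8217 / real k" if a: "a \<in> C" for a
  proof -
    have V0: "real (card V) > 0" using finV by (simp add: card_gt_0_iff)
    have "real (card {v \<in> V. prefers_over P v a T}) \<le> real (card {v \<in> V. prefers_over P v a S})"
      using finV T(1) by (auto simp: prefers_over_def intro!: card_mono)
    also have "\<dots> = (\<Sum>v\<in>V. of_bool (prefers_over P v a S))"
      using finV by (simp add: of_bool_def sum.If_cases Int_def)
    finally have "real k * real (card {v \<in> V. prefers_over P v a T}) \<le> 8 * real (card V)"
      using S(3)[OF a] by (meson mult_left_mono of_nat_0_le_iff order_trans)
    then have "dom_frac V P a T \<le> 8 / real k"
      using V0 assms(2) by (simp add: dom_frac_def field_simps)
    \<comment> \<open>The gap between \<open>8\<close> and \<open>9.8217\<close> supplies the strict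
      inequality.\<close>
    also have "\<dots> < 9.8217 / real k" using assms(2) by (intro divide_strict_right_mono) auto
    finally show ?thesis .
  qed
  then show ?thesis using T by (auto simp: undominated_def)
qed

end
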